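(* Let $\mathfrak{h}$ be a 6-dimensional real Lie algebra endowed with a half-flat $\mathrm{SU}(3)$-structure $(\omega,\psi_+)$. Let $D$ be a derivation of $\mathfrak{h}$ such that $D\in\mathfrak{sp}(6,\mathbb{R})$ with respect to a basis $\{e_1,\dots,e_6\}$ of $\mathfrak{h}$ in which $\omega,\psi_+,\psi_-$ have the canonical expression. Then the 7-dimensional Lie algebra $\mathfrak{g}=\mathfrak{h}\oplus_D\mathbb{R}\xi$ has a coclosed $\mathrm{G}_2$ form.
   Context: Notation: for a basis $\{e_i\}$ of a Lie algebra with dual basis $\{e^i\}$, $e^{ij}=e^i\wedge e^j$, $e^{ijk}=e^i\wedge e^j\wedge e^k$, etc. $d$ is the Chevalley–Eilenberg differential, with $d\alpha(X,Y)=-\alpha([X,Y])$ on 1-forms. An $\mathrm{SU}(3)$-structure on a 6-dimensional real Lie algebra $\mathfrak{h}$ is given by a pair $(\omega,\psi_+)\in\Lambda^2\mathfrak{h}^*\times\Lambda^3\mathfrak{h}^*$ for which there is a basis $\{e_1,\dots,e_6\}$ of $\mathfrak{h}$ (orthonormal for the associated metric) in which $\omega=e^{12}+e^{34}+e^{56}$, $\psi_+=e^{135}-e^{146}-e^{236}-e^{245}$; the pair determines $\psi_-=e^{136}+e^{145}+e^{235}-e^{246}$. These formulas are "the canonical expression" of $\omega,\psi_+,\psi_-$. The structure is half-flat if $d(\omega\wedge\omega)=0$ and $d\psi_+=0$. $D\in\mathfrak{sp}(6,\mathbb{R})$ with respect to $\{e_1,\dots,e_6\}$ means that $\omega(DX,Y)+\omega(X,DY)=0$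 for all $X,Y\in\mathfrak{h}$, where $\omega=e^{12}+e^{34}+e^{56}$; equivalently the matrix of $D$ is of the form $$\begin{pmatrix} a_{11} & a_{12} & a_{13} & a_{14} & a_{15} & a_{16} \\ a_{21} & -a_{11} & a_{23} & a_{24} & a_{25} & a_{26} \\ -a_{24} & a_{14} & a_{33} & a_{34} & a_{35} & a_{36} \\ a_{23} & -a_{13} & a_{43} & -a_{33} & a_{45} & a_{46} \\ -a_{26} & a_{16} & -a_{46} & a_{36} & a_{55} & a_{56} \\ a_{25} & -a_{15} & a_{45} & -a_{35} & a_{65} & -a_{55} \end{pmatrix},\quad a_{ij}\in\mathbb{R}.$$ For a derivation $D$ of $\mathfrak{h}$, $\mathfrak{h}\oplus_D\mathbb{R}\xi$ is the vector space $\mathfrak{h}\oplus\mathbb{R}\xi$ with bracket extending that of $\mathfrak{h}$ and $[\xi,U]=D(U)$ for $U\in\mathfrak{h}$. A $\mathrm{G}_2$ form on a 7-dimensional real Lie algebra $\mathfrak{g}$ is a 3-form $\varphi$ which, with respect to some basis $\{e^1,\dots,e^7\}$ of $\mathfrak{g}^*$, can be written as $\varphi=e^{127}+e^{347}+e^{567}+e^{246}-e^{235}-e^{145}-e^{136}$. It induces the metric and orientation for which $\{e^1,\dots,e^7\}$ is an oriented orthonormal basis, with Hodge star $\ast$. It is coclosed if $d\ast\varphi=0$. *)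

theory Defs
  imports "HOL-Analysis.Analysis" "HOL-Library.Function_Algebras"
begin

section \<open>Lie algebras\<close>

definition lie_algebra :: "('a::real_vector \<Rightarrow> 'a \<Rightarrow> 'a) \<Rightarrow> bool" where
  "lie_algebra br \<longleftrightarrow> bilinear br \<and> (\<forall>x. br x x = 0) \<and>
     (\<forall>x y z. br x (br y z) + br y (br z x) + br z (br x y) = 0)"

definition derivation :: "('a::real_vector \<Rightarrow> 'a \<Rightarrow> 'a) \<Rightarrow> ('a \<Rightarrow> 'a) \<Rightarrow> bool" where
  "derivation br D \<longleftrightarrow> linear D \<and> (\<forall>x y. D (br x y) = br (D x) y + br x (D y))"

text \<open>The space \<open>h \<oplus> \<real>\<xi>\<close> is \<open>'a \<times> real\<close> with \<open>\<xi> = (0, 1)\<close>, and \<open>[\<xi>, U] = D U\<close>.\<close>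

definition semidirect_bracket ::
  "('a::real_vector \<Rightarrow> 'a \<Rightarrow> 'a) \<Rightarrow> ('a \<Rightarrow> 'a) \<Rightarrow> 'a \<times> real \<Rightarrow> 'a \<times> real \<Rightarrow> 'a \<times> real" where
  "semidirect_bracket br D = (\<lambda>(x, s) (y, t). (br x y + s *\<^sub>R D y - t *\<^sub>R D x, 0))"

lemma lie_algebra_semidirect_bracket:
  assumes "lie_algebra br" and "derivation br D"
  shows "lie_algebra (semidirect_bracket br D)"
proof -
  have bil: "bilinear br" and alt: "\<And>x. br x x = 0"
    and jac: "\<And>x y z. br x (br y z) + br y (br z x) + br z (br x y) = 0"
    using assms(1) by (auto simp: lie_algebra_def)
  have lin: "linear D" and der: "\<And>x y. D (br x y) = br (D x) y + br x (D y)"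
    using assms(2) by (auto simp: derivation_def)
  note br = bilinear_ladd[OF bil] bilinear_radd[OF bil] bilinear_lmul[OF bil]
    bilinear_rmul[OF bil] bilinear_lsub[OF bil] bilinear_rsub[OF bil]
  note D = linear_add[OF lin] linear_diff[OF lin] linear_scale[OF lin]
  have anti: "br x y = - br y x" for x y
    using alt[of "x + y"] alt[of x] alt[of y]
    by (simp add: br eq_neg_iff_add_eq_0 add.commute)
  have "bilinear (semidirect_bracket br D)"
    unfolding bilinear_def semidirect_bracket_def
    by (auto intro!: linearI simp: br D algebra_simps)
  moreover have "semidirect_bracket br D p p = 0" for p
    by (cases p) (simp add: semidirect_bracket_def alt zero_prod_def)
  moreover have "semidirect_bracket br D p (semidirect_bracket br D q r)
      + semidirect_bracket br D q (semidirect_bracket br D r p)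
      + semidirect_bracket br D r (semidirect_bracket br D p q) = 0" for p q r
  proof -
    obtain x s y t z u where [simp]: "p = (x, s)" "q = (y, t)" "r = (z, u)"
      by (cases p, cases q, cases r) auto
    have "br x (br y z) + (br y (br z x) + br z (br x y)) = 0"
      using jac[of x y z] by (simp add: add.assoc)
    moreover have "br (D y) z = - br z (D y)" "br (D z) x = - br x (D z)"
      "br (D x) y = - br y (D x)" using anti by blast+
    ultimately show ?thesis
      by (simp add: semidirect_bracket_def zero_prod_def br D der algebra_simps)
  qed
  ultimately show ?thesis by (simp add: lie_algebra_def)
qed

section \<open>Exterior forms\<close>

text \<open>
  A \<open>k\<close>-form is encoded as a function \<open>'a list \<Rightarrow> real\<close> whose value on \<open>[x\<^sub>1, \<dots>, x\<^sub>k]\<close> is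
  \<open>\<alpha>(x\<^sub>1, \<dots>, x\<^sub>k)\<close> and which vanishes on lists of any other length. Thus sums of forms are
  pointwise, and no degree needs to be passed to the operations below.
\<close>

type_synonym 'a form = "'a list \<Rightarrow> real"

text \<open>The sign of the shuffle that lists the elements of \<open>A\<close> in increasing order, followed by
  those of its complement in increasing order.\<close>

definition shuffle_sign :: "nat set \<Rightarrow> real" where
  "shuffle_sign A = (-1) ^ card {(i, j). i \<in> A \<and> j \<notin> A \<and> j < i}"

text \<open>The wedge product, as a sum over shuffles, so that
  \<open>(\<alpha> \<and> \<beta>)(x, y) = \<alpha>(x) \<beta>(y) - \<alpha>(y) \<beta>(x)\<close> for 1-forms. For forms of degrees \<open>p\<close> and \<open>q\<close>,
  only lists of length \<open>p + q\<close> and sets \<open>A\<close> with \<open>p\<close> elements contribute.\<close>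

definition wedge :: "'a form \<Rightarrow> 'a form \<Rightarrow> 'a form" where
  "wedge \<alpha> \<beta> xs =
     (\<Sum>A\<in>Pow {..<length xs}. shuffle_sign A * \<alpha> (nths xs A) * \<beta> (nths xs (- A)))"

text \<open>The Chevalley--Eilenberg differential
  \<open>d\<alpha>(x\<^sub>0, \<dots>, x\<^sub>k) = \<Sum>\<^sub>i\<^sub><\<^sub>j (-1)\<^sup>i\<^sup>+\<^sup>j \<alpha>([x\<^sub>i, x\<^sub>j], x\<^sub>0, \<dots>, x\<^sub>k)\<close>, with \<open>x\<^sub>i\<close> and \<open>x\<^sub>j\<close> omitted from the
  tail; in particular \<open>d\<alpha>(x, y) = -\<alpha>([x, y])\<close> for 1-forms.\<close>

definition CE_d :: "('a \<Rightarrow> 'a \<Rightarrow> 'a) \<Rightarrow> 'a form \<Rightarrow> 'a form" where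
  "CE_d br \<alpha> xs =
     (\<Sum>(i, j)\<in>{(i, j). i < j \<and> j < length xs}.
        (-1) ^ (i + j) * \<alpha> (br (xs ! i) (xs ! j) # nths xs (- {i, j})))"

definition is_basis :: "'a::real_vector list \<Rightarrow> bool" where
  "is_basis E \<longleftrightarrow> distinct E \<and> independent (set E) \<and> span (set E) = UNIV"

text \<open>The dual basis element \<open>e\<^sup>i\<close>, with indices starting from 1: the basis is
  \<open>E = [e\<^sub>1, \<dots>, e\<^sub>n]\<close>, so \<open>e\<^sub>i = E ! (i - 1)\<close>.\<close>

definition dual_basis :: "'a::real_vector list \<Rightarrow> nat \<Rightarrow> 'a form" where
  "dual_basis E i xs =
     (case xs of [x] \<Rightarrow> representation (set E) x (E ! (i - 1)) | _ \<Rightarrow> 0)"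

text \<open>\<open>basis_form E [i, j, \<dots>, k] = e\<^sup>i \<and> e\<^sup>j \<and> \<dots> \<and> e\<^sup>k\<close>; the initial value is the 0-form \<open>1\<close>.\<close>

definition basis_form :: "'a::real_vector list \<Rightarrow> nat list \<Rightarrow> 'a form" where
  "basis_form E is =
     foldr (\<lambda>i. wedge (dual_basis E i)) is (\<lambda>xs. if xs = [] then 1 else 0)"

text \<open>The Hodge star of the metric and orientation for which the basis \<open>E\<close> is orthonormal and
  positively oriented: the linear map with \<open>\<star>e\<^sup>I = \<plusminus>e\<^sup>J\<close>, where \<open>J\<close> is the complement of \<open>I\<close> and
  the sign is such that \<open>e\<^sup>I \<and> \<star>e\<^sup>I = e\<^sup>1 \<and> \<dots> \<and> e\<^sup>n\<close>. The coefficient of \<open>e\<^sup>I\<close> in \<open>\<alpha>\<close> is the value of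
  \<open>\<alpha>\<close> on the vectors \<open>e\<^sub>i\<close>, \<open>i \<in> I\<close>. Here \<open>I\<close> consists of list positions, starting from 0.\<close>

definition hodge_star :: "'a::real_vector list \<Rightarrow> 'a form \<Rightarrow> 'a form" where
  "hodge_star E \<alpha> xs =
     (\<Sum>I\<in>Pow {..<length E}. shuffle_sign I * \<alpha> (nths E I)
        * basis_form E (nths [1..<Suc (length E)] (- I)) xs)"

section \<open>SU(3)-structures\<close>

definition std_omega :: "'a::real_vector list \<Rightarrow> 'a form" where
  "std_omega E = basis_form E [1,2] + basis_form E [3,4] + basis_form E [5,6]"

definition std_psi_plus :: "'a::real_vector list \<Rightarrow> 'a form" where
  "std_psi_plus E =
     basis_form E [1,3,5] - basis_form E [1,4,6] - basis_form E [2,3,6] - basis_form E [2,4,5]"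

definition std_psi_minus :: "'a::real_vector list \<Rightarrow> 'a form" where
  "std_psi_minus E =
     basis_form E [1,3,6] + basis_form E [1,4,5] + basis_form E [2,3,5] - basis_form E [2,4,6]"

definition SU3_structure :: "'a::real_vector form \<Rightarrow> 'a form \<Rightarrow> bool" where
  "SU3_structure \<omega> \<psi>p \<longleftrightarrow>
     (\<exists>E. is_basis E \<and> length E = 6 \<and> \<omega> = std_omega E \<and> \<psi>p = std_psi_plus E)"

definition half_flat :: "('a \<Rightarrow> 'a \<Rightarrow> 'a) \<Rightarrow> 'a::real_vector form \<Rightarrow> 'a form \<Rightarrow> bool" where
  "half_flat br \<omega> \<psi>p \<longleftrightarrow>
     SU3_structure \<omega> \<psi>p \<and> CE_d br (wedge \<omega> \<omega>) = 0 \<and> CE_d br \<psi>p = 0"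

definition canonical_basis ::
  "'a::real_vector list \<Rightarrow> 'a form \<Rightarrow> 'a form \<Rightarrow> 'a form \<Rightarrow> bool" where
  "canonical_basis E \<omega> \<psi>p \<psi>m \<longleftrightarrow> is_basis E \<and> length E = 6 \<and>
     \<omega> = std_omega E \<and> \<psi>p = std_psi_plus E \<and> \<psi>m = std_psi_minus E"

definition in_sp6 :: "'a::real_vector list \<Rightarrow> ('a \<Rightarrow> 'a) \<Rightarrow> bool" where
  "in_sp6 E D \<longleftrightarrow> linear D \<and>
     (\<forall>x y. std_omega E [D x, y] + std_omega E [x, D y] = 0)"

section \<open>\<open>G\<^sub>2\<close> forms\<close>

definition G2_adapted :: "'a::real_vector list \<Rightarrow> 'a form \<Rightarrow> bool" where
  "G2_adapted E \<phi> \<longleftrightarrow> is_basis E \<and> length E = 7 \<and>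
     \<phi> = basis_form E [1,2,7] + basis_form E [3,4,7] + basis_form E [5,6,7]
       + basis_form E [2,4,6] - basis_form E [2,3,5] - basis_form E [1,4,5] - basis_form E [1,3,6]"

definition G2_form :: "'a::real_vector form \<Rightarrow> bool" where
  "G2_form \<phi> \<longleftrightarrow> (\<exists>E. G2_adapted E \<phi>)"

text \<open>The metric and orientation, hence the Hodge star, do not depend on the choice of the adapted
  basis \<open>E\<close>, because the stabilizer \<open>G\<^sub>2\<close> of \<open>\<phi>\<close> is contained in \<open>SO(7)\<close>.\<close>

definition coclosed :: "('a \<Rightarrow> 'a \<Rightarrow> 'a) \<Rightarrow> 'a::real_vector form \<Rightarrow> bool" where
  "coclosed br \<phi> \<longleftrightarrow> (\<exists>E. G2_adapted E \<phi> \<and> CE_d br (hodge_star E \<phi>) = 0)"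

end

theory Submission
  imports Defs
begin

text \<open>
  Let \<open>\<eta>\<close> be the 1-form on \<open>h \<oplus> \<real>\<xi>\<close> that is dual to \<open>\<xi>\<close>, so that \<open>d\<eta> = 0\<close>. The form
  \<open>\<phi> = \<omega> \<and> \<eta> - \<psi>\<^sub>-\<close> is a \<open>G\<^sub>2\<close> form with adapted basis \<open>e\<^sub>1, \<dots>, e\<^sub>6, \<xi>\<close>, and
  \<open>\<star>\<phi> = (\<omega> \<and> \<omega>) / 2 + \<psi>\<^sub>+ \<and> \<eta>\<close>. On \<open>h \<oplus> \<real>\<xi>\<close>, the form \<open>d(\<omega> \<and> \<omega>)\<close> differs from its value on
  \<open>h\<close> only by \<open>\<plusminus> D(\<omega> \<and> \<omega>) \<and> \<eta>\<close>, which vanishes for symplectic \<open>D\<close>; and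
  \<open>d(\<psi>\<^sub>+ \<and> \<eta>) = d\<psi>\<^sub>+ \<and> \<eta>\<close>, since the \<open>D\<close>-part of \<open>d\<psi>\<^sub>+\<close> is a multiple of \<open>\<eta>\<close>. So \<open>d\<star>\<phi> = 0\<close>
  follows from half-flatness.
\<close>

section \<open>Basis forms\<close>

lemma nths_singleton_index: "j < length xs \<Longrightarrow> nths xs {j} = [xs ! j]"
proof (induction xs arbitrary: j)
  case (Cons x xs)
  show ?case
  proof (cases j)
    case 0
    then show ?thesis by (simp add: nths_Cons)
  next
    case (Suc k)
    then have "{i. Suc i \<in> {j}} = {k}" by auto
    with Suc Cons show ?thesis by (simp add: nths_Cons)
  qed
qed simp

lemma nths_Compl_singleton: "nths xs (- {j}) = take j xs @ drop (Suc j) xs"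
proof (induction xs arbitrary: j)
  case (Cons x xs)
  show ?case
  proof (cases j)
    case 0
    have "{i. Suc i \<in> - {0}} = UNIV" by auto
    with 0 show ?thesis by (simp add: nths_Cons nths_all)
  next
    case (Suc k)
    then have "{i. Suc i \<in> - {j}} = - {k}" by auto
    with Suc Cons show ?thesis by (simp add: nths_Cons)
  qed
qed simp

lemma shuffle_sign_singleton: "shuffle_sign {j} = (-1) ^ j"
proof -
  have "{(i, k). i \<in> {j} \<and> k \<notin> {j} \<and> k < i} = Pair j ` {..<j}" by auto
  then show ?thesis by (simp add: shuffle_sign_def card_image inj_on_def)
qed

text \<open>Counting the inversions one element of \<open>A\<close> at a time gives a form that can
  be evaluated for explicit sets.\<close>

lemma shuffle_sign_eq_sum:
  assumes "finite A"
  shows "shuffle_sign A = (-1) ^ (\<Sum>i\<in>A. card ({..<i} - A))"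
proof -
  have "{(i, j). i \<in> A \<and> j \<notin> A \<and> j < i} = (SIGMA i:A. {..<i} - A)" by auto
  with assms show ?thesis by (simp add: shuffle_sign_def)
qed

lemma length_nths_subset: "A \<subseteq> {..<length xs} \<Longrightarrow> length (nths xs A) = card A"
  unfolding length_nths by (rule arg_cong[where f = card]) auto

text \<open>A 1-form vanishes on sublists of length other than one, so only the singletons survive
  in the sum over shuffles. The result is a Laplace expansion.\<close>

lemma wedge_dual_basis:
  "wedge (dual_basis E i) \<beta> xs =
     (\<Sum>j<length xs. (-1) ^ j * dual_basis E i [xs ! j] * \<beta> (take j xs @ drop (Suc j) xs))"
proof -
  let ?f = "\<lambda>A. shuffle_sign A * dual_basis E i (nths xs A) * \<beta> (nths xs (- A))"
  have "wedge (dual_basis E i) \<beta> xs = sum ?f ((\<lambda>j. {j}) ` {..<length xs})"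
    unfolding wedge_def
  proof (rule sum.mono_neutral_right)
    show "\<forall>A\<in>Pow {..<length xs} - (\<lambda>j. {j}) ` {..<length xs}. ?f A = 0"
    proof
      fix A assume A: "A \<in> Pow {..<length xs} - (\<lambda>j. {j}) ` {..<length xs}"
      then have "card A \<noteq> 1" by (auto simp: card_1_singleton_iff)
      with A have "length (nths xs A) \<noteq> 1" by (simp add: length_nths_subset)
      then have "dual_basis E i (nths xs A) = 0"
        by (auto simp: dual_basis_def split: list.split)
      then show "?f A = 0" by simp
    qed
  qed auto
  also have "\<dots> = (\<Sum>j<length xs. ?f {j})"
    by (subst sum.reindex) (auto simp: inj_on_def)
  finally show ?thesis
    by (simp add: nths_singleton_index nths_Compl_singleton shuffle_sign_singleton)
qed

section \<open>Basis forms by Laplace expansion\<close>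

lemma basis_form_Nil: "basis_form E [] xs = (if xs = [] then 1 else 0)"
  by (simp add: basis_form_def)

lemma basis_form_Cons:
  "basis_form E (i # is) xs = (\<Sum>j<length xs. (-1) ^ j * dual_basis E i [xs ! j]
     * basis_form E is (take j xs @ drop (Suc j) xs))"
  by (simp add: basis_form_def wedge_dual_basis)

lemma basis_form_length:
  "length xs \<noteq> length is \<Longrightarrow> basis_form E is xs = 0"
proof (induction "is" arbitrary: xs)
  case (Cons i "is")
  then show ?case
    unfolding basis_form_Cons by (intro sum.neutral) auto
qed (simp add: basis_form_Nil)

lemma is_basis_dual_basis:
  assumes "is_basis E" "a < length E" "1 \<le> i" "i \<le> length E"
  shows "dual_basis E i [E ! a] = (if i = Suc a then 1 else 0)"
  using assms
  by (auto simp: is_basis_def dual_basis_def representation_basis nth_eq_iff_index_eq)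

text \<open>Duality of \<open>e\<^sup>I\<close> and \<open>e\<^sub>J\<close> for increasing indices.
  In the Laplace expansion along \<open>i\<close>, a nonzero term picks \<open>i\<close> out of
  \<open>js\<close> and matches the rest with \<open>is\<close>; as \<open>i\<close> is the least
  index, it must be picked from position 0.\<close>

lemma basis_form_increasing:
  assumes "is_basis E"
    and "sorted_wrt (<) is" "\<forall>i\<in>set is. 1 \<le> i \<and> i \<le> length E"
    and "sorted_wrt (<) js" "\<forall>j\<in>set js. 1 \<le> j \<and> j \<le> length E"
  shows "basis_form E is (map (\<lambda>j. E ! (j - 1)) js) = (if is = js then 1 else 0)"
  using assms(2-5)
proof (induction "is" arbitrary: js)
  case Nil
  then show ?case by (simp add: basis_form_Nil)
next
  case (Cons i "is")
  let ?v = "\<lambda>j. E ! (j - 1)"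
  have summand: "(-1) ^ k * dual_basis E i [map ?v js ! k]
       * basis_form E is (take k (map ?v js) @ drop (Suc k) (map ?v js))
     = (if k = 0 \<and> i # is = js then 1 else 0)" if k: "k < length js" for k
  proof -
    let ?r = "take k js @ drop (Suc k) js"
    have js: "js = take k js @ js ! k # drop (Suc k) js"
      using k by (simp add: id_take_nth_drop[symmetric])
    have "sorted_wrt (<) (take k js @ js ! k # drop (Suc k) js)"
      using Cons.prems(3) js by simp
    then have s: "sorted_wrt (<) ?r" by (auto simp: sorted_wrt_append)
    have r: "\<forall>j\<in>set ?r. 1 \<le> j \<and> j \<le> length E"
      using Cons.prems(4) by (auto dest: in_set_takeD in_set_dropD)
    have "basis_form E is (map ?v ?r) = (if is = ?r then 1 else 0)"
      using Cons.IH[OF _ _ s r] Cons.prems by simp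
    \<comment> \<open>Indices start at 1, so this bound keeps the truncated subtraction
      \<open>js ! k - 1\<close> honest.\<close>
    moreover have "1 \<le> js ! k \<and> js ! k \<le> length E" using Cons.prems(4) k by simp
    then have "dual_basis E i [?v (js ! k)] = (if i = js ! k then 1 else 0)"
      using is_basis_dual_basis[OF assms(1), of "js ! k - 1" i] Cons.prems(2)
      by (cases "js ! k") auto
    moreover have "k = 0 \<and> i # is = js" if "i = js ! k" "is = ?r"
    proof (cases k)
      case 0
      with that js show ?thesis by simp
    next
      \<comment> \<open>For \<open>k > 0\<close> the head of \<open>js\<close> remains in
        \<open>is\<close>, so \<open>i < js ! 0 < js ! k\<close>, against
        \<open>i = js ! k\<close>.\<close>
      case (Suc l)
      with k that have "js ! 0 \<in> set is" by (cases js) auto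
      with Cons.prems(1) have "i < js ! 0" by auto
      moreover have "js ! 0 < js ! k"
        using Cons.prems(3) k Suc by (simp add: sorted_wrt_iff_nth_less)
      ultimately show ?thesis using that by simp
    qed
    moreover have "i = js ! k \<and> is = ?r" if "k = 0" "i # is = js"
      using that by auto
    ultimately show ?thesis using k by (auto simp: take_map drop_map)
  qed
  have "basis_form E (i # is) (map ?v js)
      = (\<Sum>k<length js. if k = 0 \<and> i # is = js then 1 else 0)"
    unfolding basis_form_Cons by (rule sum.cong) (use summand in auto)
  then show ?case by (auto simp: if_distrib sum.delta conj_commute cong: if_cong)
qed

section \<open>The Hodge star on basis forms\<close>

lemma nths_eq_map_nths: "nths E I = map (\<lambda>j. E ! (j - 1)) (nths [1..<Suc (length E)] I)"
proof -
  have "E = map (\<lambda>j. E ! (j - 1)) [1..<Suc (length E)]"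
    by (rule nth_equalityI) (auto simp del: upt_Suc)
  then show ?thesis by (metis nths_map)
qed

text \<open>By \<open>basis_form_increasing\<close>, the coefficient of the form at \<open>I\<close>
  is 1 for \<open>I = J\<close> and 0 otherwise, so a single summand is left.\<close>

lemma hodge_star_basis_form:
  assumes "is_basis E" "J \<subseteq> {..<length E}"
  shows "hodge_star E (basis_form E (nths [1..<Suc (length E)] J)) xs
    = shuffle_sign J * basis_form E (nths [1..<Suc (length E)] (- J)) xs"
proof -
  let ?u = "[1..<Suc (length E)]"
  have sorted: "sorted_wrt (<) (nths ?u I)" for I
    by (simp add: strict_sorted_iff sorted_nths distinct_nthsI del: upt_Suc)
  have range: "\<forall>i\<in>set (nths ?u I). 1 \<le> i \<and> i \<le> length E" for I
    using set_nths_subset[of ?u I] by (force simp del: upt_Suc)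
  \<comment> \<open>Position \<open>a\<close> of the index list holds \<open>Suc a\<close>, so the
    selected sublist determines the set of positions.\<close>
  have inj: "I = J" if "nths ?u I = nths ?u J" "I \<subseteq> {..<length E}" for I
  proof -
    have *: "set (nths ?u K) = Suc ` K" if "K \<subseteq> {..<length E}" for K
    proof -
      have "set (nths ?u K) = (\<lambda>i. ?u ! i) ` K"
        using that by (auto simp: set_nths simp del: upt_Suc)
      also have "\<dots> = Suc ` K"
        using that by (intro image_cong) (auto simp del: upt_Suc)
      finally show ?thesis .
    qed
    have "Suc ` I = Suc ` J" using *[OF assms(2)] *[OF that(2)] that(1) by simp
    then show ?thesis by (simp add: inj_image_eq_iff)
  qed
  have "basis_form E (nths ?u J) (nths E I) = (if I = J then 1 else 0)"
    if "I \<in> Pow {..<length E}" for I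
    using basis_form_increasing[OF assms(1) sorted range sorted range, of J I] inj[of I] that
    by (auto simp: nths_eq_map_nths[of E] simp del: upt_Suc)
  then have "hodge_star E (basis_form E (nths ?u J)) xs
      = (\<Sum>I\<in>Pow {..<length E}. if I = J then shuffle_sign J * basis_form E (nths ?u (- J)) xs else 0)"
    unfolding hodge_star_def by (intro sum.cong) auto
  also have "\<dots> = shuffle_sign J * basis_form E (nths ?u (- J)) xs"
    using assms(2) by simp
  finally show ?thesis .
qed

lemma hodge_star_add: "hodge_star E (\<alpha> + \<beta>) = hodge_star E \<alpha> + hodge_star E \<beta>"
  by (rule ext) (simp add: hodge_star_def sum.distrib algebra_simps)

lemma hodge_star_diff: "hodge_star E (\<alpha> - \<beta>) = hodge_star E \<alpha> - hodge_star E \<beta>"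
  by (rule ext) (simp add: hodge_star_def sum_subtractf algebra_simps fun_diff_def)

section \<open>The differential as a nested sum that unfolds on explicit lists, and its
  degree\<close>

lemma CE_d_eq_sum:
  "CE_d br \<alpha> xs = (\<Sum>j<length xs. \<Sum>i<j.
     (-1) ^ (i + j) * \<alpha> (br (xs ! i) (xs ! j) # nths xs (- {i, j})))"
proof -
  let ?f = "\<lambda>i j. (-1) ^ (i + j) * \<alpha> (br (xs ! i) (xs ! j) # nths xs (- {i, j}))"
  have "(\<Sum>j<length xs. \<Sum>i<j. ?f i j)
      = (\<Sum>(j, i)\<in>(SIGMA j:{..<length xs}. {..<j}). ?f i j)"
    by (simp add: sum.Sigma)
  also have "\<dots> = CE_d br \<alpha> xs"
    unfolding CE_d_def by (rule sum.reindex_bij_witness[where i = prod.swap and j = prod.swap]) auto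
  finally show ?thesis ..
qed

lemma CE_d_length:
  assumes "\<And>ys. length ys \<noteq> n \<Longrightarrow> \<alpha> ys = 0" "length xs \<noteq> Suc n"
  shows "CE_d br \<alpha> xs = 0"
proof -
  have "\<alpha> (br (xs ! i) (xs ! j) # nths xs (- {i, j})) = 0" if "i < j" "j < length xs" for i j
  proof -
    have "{k. k < length xs \<and> k \<in> - {i, j}} = {..<length xs} - {i, j}" by auto
    then have "length (nths xs (- {i, j})) = length xs - 2"
      using that by (simp add: length_nths card_Diff_subset)
    with that assms show ?thesis by auto
  qed
  then show ?thesis by (auto simp: CE_d_eq_sum intro!: sum.neutral)
qed

section \<open>The basis of \<open>h \<oplus> \<real>\<xi>\<close> and its dual\<close>

definition extended_basis :: "'a::real_vector list \<Rightarrow> ('a \<times> real) list" where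
  "extended_basis E = map (\<lambda>e. (e, 0)) E @ [(0, 1)]"

lemma linear_Pair_zero: "linear (\<lambda>x::'a::real_vector. (x, 0::real))"
  by (rule linearI) auto

lemma is_basis_extended_basis:
  assumes "is_basis E"
  shows "is_basis (extended_basis E)"
proof -
  let ?i = "\<lambda>x::'a. (x, 0::real)"
  have span: "span (?i ` set E) = range ?i"
    using assms by (simp add: is_basis_def linear_span_image[OF linear_Pair_zero])
  have set: "set (extended_basis E) = insert (0, 1) (?i ` set E)"
    by (auto simp: extended_basis_def)
  have "distinct (extended_basis E)"
    using assms by (auto simp: extended_basis_def is_basis_def distinct_map inj_on_def)
  moreover have "independent (?i ` set E)"
    using assms
    by (intro linear_independent_injective_image[OF linear_Pair_zero])
       (auto simp: is_basis_def inj_on_def)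
  then have "independent (set (extended_basis E))"
    unfolding set by (rule independent_insertI[rotated]) (auto simp: span)
  moreover have "span (set (extended_basis E)) = UNIV"
  proof -
    \<comment> \<open>Removing the component along \<open>\<xi> = (0, 1)\<close> leaves a vector in
      the copy of \<open>h\<close>.\<close>
    have "p - snd p *\<^sub>R (0, 1) \<in> span (?i ` set E)" for p
      unfolding span by (cases p) auto
    then show ?thesis unfolding set by (auto simp: span_insert)
  qed
  ultimately show ?thesis by (simp add: is_basis_def)
qed

lemma linear_dual_basis:
  assumes "is_basis E"
  shows "linear (\<lambda>x. dual_basis E i [x])"
  using assms unfolding dual_basis_def is_basis_def
  by (auto intro!: linearI simp: representation_add representation_scale)

text \<open>Both sides are linear in \<open>(x, s)\<close>, so it suffices to compare them on the
  extended basis. Since \<open>\<xi>\<close> is listed last, the last dual vector is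
  \<open>\<eta>\<close>.\<close>

lemma dual_basis_extended_basis:
  assumes "is_basis E" "1 \<le> i" "i \<le> Suc (length E)"
  shows "dual_basis (extended_basis E) i [(x, s)]
    = (if i \<le> length E then dual_basis E i [x] else s)"
proof -
  note basis' = is_basis_extended_basis[OF assms(1)]
  let ?g = "\<lambda>p. if i \<le> length E then dual_basis E i [fst p] else snd p"
  have "linear ?g"
    using linear_add[OF linear_dual_basis[OF assms(1), of i]]
      linear_scale[OF linear_dual_basis[OF assms(1), of i]]
    by (auto intro!: linearI)
  moreover have "dual_basis (extended_basis E) i [p] = ?g p" if "p \<in> set (extended_basis E)" for p
  proof -
    obtain a where a: "a < length (extended_basis E)" "p = extended_basis E ! a"
      using \<open>p \<in> _\<close> by (metis in_set_conv_nth)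
    have len: "length (extended_basis E) = Suc (length E)" by (simp add: extended_basis_def)
    have "dual_basis (extended_basis E) i [p] = (if i = Suc a then 1 else 0)"
      using is_basis_dual_basis[OF basis' a(1), of i] assms a len by simp
    also have "\<dots> = ?g p"
    proof (cases "a < length E")
      case True
      then show ?thesis using a(2) assms
        by (auto simp: extended_basis_def nth_append is_basis_dual_basis)
    next
      case False
      with a len have "a = length E" by simp
      moreover have "dual_basis E i [0] = 0"
        using linear_0[OF linear_dual_basis[OF assms(1)]] .
      ultimately show ?thesis using a(2) assms by (auto simp: extended_basis_def nth_append)
    qed
    finally show ?thesis .
  qed
  moreover have "(x, s) \<in> span (set (extended_basis E))"
    using basis' by (simp add: is_basis_def)
  ultimately show ?thesis
    using linear_eq_on[OF linear_dual_basis[OF basis'], of ?g] by fastforce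
qed

text \<open>Only the six two-element sets of positions contribute, since \<alpha> vanishes on lists
  of any other length.\<close>

lemma wedge_2_forms:
  assumes "\<And>xs. length xs \<noteq> 2 \<Longrightarrow> \<alpha> xs = 0"
  shows "wedge \<alpha> \<beta> [x, y, z, w] = \<alpha> [x, y] * \<beta> [z, w] - \<alpha> [x, z] * \<beta> [y, w]
    + \<alpha> [x, w] * \<beta> [y, z] + \<alpha> [y, z] * \<beta> [x, w] - \<alpha> [y, w] * \<beta> [x, z] + \<alpha> [z, w] * \<beta> [x, y]"
proof -
  let ?S = "{{0, Suc 0}, {0, 2}, {0, 3}, {Suc 0, 2}, {Suc 0, 3}, {2, 3}} :: nat set set"
  let ?f = "\<lambda>A. shuffle_sign A * \<alpha> (nths [x, y, z, w] A) * \<beta> (nths [x, y, z, w] (- A))"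
  have "wedge \<alpha> \<beta> [x, y, z, w] = sum ?f ?S"
    unfolding wedge_def
  proof (rule sum.mono_neutral_right)
    show "\<forall>A\<in>Pow {..<length [x, y, z, w]} - ?S. ?f A = 0"
    proof
      fix A assume A: "A \<in> Pow {..<length [x, y, z, w]} - ?S"
      have "card A \<noteq> 2"
      proof
        assume "card A = 2"
        then obtain i j where ij: "A = {i, j}" "i < j"
          by (auto simp: card_2_iff insert_commute neq_iff)
        have "A \<subseteq> {..<length [x, y, z, w]}" "A \<notin> ?S" using A by blast+
        then have j: "j < 4" and notin: "{i, j} \<notin> ?S" unfolding ij by simp_all
        from ij(2) j have "i = 0 \<and> j = Suc 0 \<or> i = 0 \<and> j = 2 \<or> i = 0 \<and> j = 3
            \<or> i = Suc 0 \<and> j = 2 \<or> i = Suc 0 \<and> j = 3 \<or> i = 2 \<and> j = 3"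
          by arith
        then have "{i, j} \<in> ?S" by (elim disjE conjE) simp_all
        with notin show False ..
      qed
      moreover from A have "length (nths [x, y, z, w] A) = card A"
        by (intro length_nths_subset) simp
      ultimately show "?f A = 0" using assms by simp
    qed
  qed auto
  also have "\<dots> = ?f {0, Suc 0} + (?f {0, 2} + (?f {0, 3} + (?f {Suc 0, 2}
      + (?f {Suc 0, 3} + ?f {2, 3}))))"
    by (simp add: doubleton_eq_iff)
  finally show ?thesis
    by (simp add: shuffle_sign_eq_sum nths_Cons)
qed

section \<open>The Hodge dual of the \<open>G\<^sub>2\<close> form\<close>

lemma hodge_star_G2_form:
  assumes "is_basis E" "length E = 7"
  shows "hodge_star E (basis_form E [1,2,7] + basis_form E [3,4,7] + basis_form E [5,6,7]
       + basis_form E [2,4,6] - basis_form E [2,3,5] - basis_form E [1,4,5] - basis_form E [1,3,6])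
     = basis_form E [3,4,5,6] + basis_form E [1,2,5,6] + basis_form E [1,2,3,4]
       + basis_form E [1,3,5,7] - basis_form E [1,4,6,7] - basis_form E [2,3,6,7]
       - basis_form E [2,4,5,7]"
proof -
  have *: "hodge_star E (basis_form E (nths [1..<8] J))
      = (\<lambda>xs. shuffle_sign J * basis_form E (nths [1..<8] (- J)) xs)" if "J \<subseteq> {..<7}" for J
    using hodge_star_basis_form[OF assms(1), of J] that assms(2) by (auto simp del: upt_Suc)
  have u: "[1..<8] = [1,2,3,4,5,6,7]" by (simp add: upt_rec)
  show ?thesis
    unfolding hodge_star_add hodge_star_diff
    \<comment> \<open>The sets are the index triples of the seven summands, in order, shifted to
      positions starting from 0.\<close>
    using *[of "{0,1,6}"] *[of "{2,3,6}"] *[of "{4,5,6}"] *[of "{1,3,5}"] *[of "{1,2,4}"]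
      *[of "{0,3,4}"] *[of "{0,2,5}"]
    unfolding u by (simp add: nths_Cons shuffle_sign_eq_sum)
qed

section \<open>Values of basis forms of low degree\<close>

lemma basis_form_2:
  "basis_form E [i, j] [x, y] = dual_basis E i [x] * dual_basis E j [y]
    - dual_basis E i [y] * dual_basis E j [x]"
  by (simp add: basis_form_Cons basis_form_Nil)

lemma basis_form_3:
  "basis_form E (i # is) [x, y, z] = dual_basis E i [x] * basis_form E is [y, z]
    - dual_basis E i [y] * basis_form E is [x, z] + dual_basis E i [z] * basis_form E is [x, y]"
  by (simp add: basis_form_Cons[of E i] eval_nat_numeral)

lemma basis_form_4:
  "basis_form E (i # is) [x, y, z, w] = dual_basis E i [x] * basis_form E is [y, z, w]
    - dual_basis E i [y] * basis_form E is [x, z, w] + dual_basis E i [z] * basis_form E is [x, y, w]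
    - dual_basis E i [w] * basis_form E is [x, y, z]"
  by (simp add: basis_form_Cons[of E i] eval_nat_numeral)

text \<open>This is \<open>e\<^sup>i\<^sup>j \<and> e\<^sup>k\<^sup>l\<close> expanded over the
  shuffles of type (2, 2).\<close>

lemma basis_form_2_2:
  "basis_form E [i, j, k, l] [x, y, z, w]
    = basis_form E [i, j] [x, y] * basis_form E [k, l] [z, w]
    - basis_form E [i, j] [x, z] * basis_form E [k, l] [y, w]
    + basis_form E [i, j] [x, w] * basis_form E [k, l] [y, z]
    + basis_form E [i, j] [y, z] * basis_form E [k, l] [x, w]
    - basis_form E [i, j] [y, w] * basis_form E [k, l] [x, z]
    + basis_form E [i, j] [z, w] * basis_form E [k, l] [x, y]"
  by (simp add: basis_form_2 basis_form_3 basis_form_4 algebra_simps)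

text \<open>Half of the value of \<open>e\<^sup>i\<^sup>j \<and> e\<^sup>i\<^sup>j = 0\<close>; it
  removes the square terms from \<omega> \<and> \<omega>.\<close>

lemma pluecker:
  "basis_form E [i, j] [x, y] * basis_form E [i, j] [z, w]
    - basis_form E [i, j] [x, z] * basis_form E [i, j] [y, w]
    + basis_form E [i, j] [x, w] * basis_form E [i, j] [y, z] = 0"
  by (simp add: basis_form_2 algebra_simps)

text \<open>On \<open>extended_basis E\<close> with six vectors in \<open>E\<close>, where
  \<open>e\<^sup>7 = \<eta>\<close>, this is
  \<open>\<omega> \<and> \<eta> - \<psi>\<^sub>-\<close>.\<close>

definition std_G2_form :: "'a::real_vector list \<Rightarrow> 'a form" where
  "std_G2_form E = basis_form E [1,2,7] + basis_form E [3,4,7] + basis_form E [5,6,7]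
       + basis_form E [2,4,6] - basis_form E [2,3,5] - basis_form E [1,4,5] - basis_form E [1,3,6]"

lemma std_omega_length: "length xs \<noteq> 2 \<Longrightarrow> std_omega E xs = 0"
  by (simp add: std_omega_def basis_form_length)

lemma wedge_std_omega:
  "wedge (std_omega E) (std_omega E) [x, y, z, w] =
    2 * (std_omega E [x, y] * std_omega E [z, w] - std_omega E [x, z] * std_omega E [y, w]
      + std_omega E [x, w] * std_omega E [y, z])"
  by (subst wedge_2_forms) (auto simp: std_omega_length)

lemma hodge_star_std_G2_form_eval:
  fixes E :: "'a::real_vector list"
  assumes "is_basis E" "length E = 6"
  shows "hodge_star (extended_basis E) (std_G2_form (extended_basis E))
      [(x, s), (y, t), (z, u), (w, v)]
    = wedge (std_omega E) (std_omega E) [x, y, z, w] / 2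
      + v * std_psi_plus E [x, y, z] - u * std_psi_plus E [x, y, w]
      + t * std_psi_plus E [x, z, w] - s * std_psi_plus E [y, z, w]"
proof -
  have len: "length (extended_basis E) = 7"
    using assms(2) by (simp add: extended_basis_def)
  have dual: "dual_basis (extended_basis E) i [(x, s)]
      = (if i \<le> 6 then dual_basis E i [x] else s)" if "1 \<le> i" "i \<le> 7" for i x s
    using dual_basis_extended_basis[OF assms(1), of i x s] that assms(2) by simp
  have 4: "basis_form (extended_basis E) [i, j, k, l] [(x, s), (y, t), (z, u), (w, v)]
      = basis_form E [i, j, k, l] [x, y, z, w]"
    if "1 \<le> i" "i \<le> 6" "1 \<le> j" "j \<le> 6" "1 \<le> k" "k \<le> 6" "1 \<le> l" "l \<le> 6" for i j k l
    using that by (simp add: basis_form_2 basis_form_3 basis_form_4 dual)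
  \<comment> \<open>Expansion of \<open>e\<^sup>i\<^sup>j\<^sup>k \<and> \<eta>\<close> along its
    last factor; \<eta> reads off the real components.\<close>
  have 7: "basis_form (extended_basis E) [i, j, k, 7] [(x, s), (y, t), (z, u), (w, v)]
      = v * basis_form E [i, j, k] [x, y, z] - u * basis_form E [i, j, k] [x, y, w]
      + t * basis_form E [i, j, k] [x, z, w] - s * basis_form E [i, j, k] [y, z, w]"
    if "1 \<le> i" "i \<le> 6" "1 \<le> j" "j \<le> 6" "1 \<le> k" "k \<le> 6" for i j k
    using that
    by (simp add: basis_form_2 basis_form_3 basis_form_4 dual) (simp add: algebra_simps)
  have "wedge (std_omega E) (std_omega E) [x, y, z, w] / 2 = basis_form E [3,4,5,6] [x, y, z, w]
      + basis_form E [1,2,5,6] [x, y, z, w] + basis_form E [1,2,3,4] [x, y, z, w]"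
    unfolding wedge_std_omega
    using pluecker[of E 1 2 x y z w] pluecker[of E 3 4 x y z w] pluecker[of E 5 6 x y z w]
    by (simp add: std_omega_def basis_form_2_2) (simp add: algebra_simps)
  then show ?thesis
    unfolding std_G2_form_def hodge_star_G2_form[OF is_basis_extended_basis[OF assms(1)] len]
    by (simp add: std_psi_plus_def 4 7 fun_diff_def) (simp add: algebra_simps)
qed

lemma hodge_star_std_G2_form_length:
  assumes "is_basis E" "length E = 7" "length xs \<noteq> 4"
  shows "hodge_star E (std_G2_form E) xs = 0"
  unfolding std_G2_form_def hodge_star_G2_form[OF assms(1,2)] using assms(3)
  by (simp add: basis_form_length fun_diff_def)

text \<open>The first slot is where \<open>CE_d\<close> inserts the brackets, so linearity there is
  what the computation of the differential uses.\<close>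

lemma linear_std_omega:
  assumes "is_basis E"
  shows "linear (\<lambda>x. std_omega E [x, y])"
  by (rule linearI) (simp_all add: std_omega_def basis_form_2 algebra_simps
      linear_add[OF linear_dual_basis[OF assms]] linear_scale[OF linear_dual_basis[OF assms]])

lemma linear_std_psi_plus:
  assumes "is_basis E"
  shows "linear (\<lambda>x. std_psi_plus E [x, y, z])"
  by (rule linearI) (simp_all add: std_psi_plus_def basis_form_2 basis_form_3 algebra_simps
      fun_diff_def
      linear_add[OF linear_dual_basis[OF assms]] linear_scale[OF linear_dual_basis[OF assms]])

lemma std_omega_swap: "std_omega E [y, x] = - std_omega E [x, y]"
  by (simp add: std_omega_def basis_form_2)

section \<open>Coclosedness on the semidirect product\<close>

lemma CE_d_3_form: "CE_d br \<alpha> [x, y, z, w] = - \<alpha> [br x y, z, w] + \<alpha> [br x z, y, w]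
    - \<alpha> [br x w, y, z] - \<alpha> [br y z, x, w] + \<alpha> [br y w, x, z] - \<alpha> [br z w, x, y]"
  by (simp add: CE_d_eq_sum nths_Cons eval_nat_numeral)

lemma CE_d_4_form: "CE_d br \<alpha> [x, y, z, w, v] = - \<alpha> [br x y, z, w, v] + \<alpha> [br x z, y, w, v]
    - \<alpha> [br x w, y, z, v] + \<alpha> [br x v, y, z, w] - \<alpha> [br y z, x, w, v] + \<alpha> [br y w, x, z, v]
    - \<alpha> [br y v, x, z, w] - \<alpha> [br z w, x, y, v] + \<alpha> [br z v, x, y, w] - \<alpha> [br w v, x, y, z]"
  by (simp add: CE_d_eq_sum nths_Cons eval_nat_numeral)

text \<open>The value of the differential is sorted into three kinds of terms: \<open>dW\<close>
  from \<omega> \<and> \<omega> on \<open>h\<close>, \<open>dP\<close> from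
  \<open>\<psi>\<^sub>+\<close> on \<open>h\<close>, and \<open>L\<close> from the action of
  \<open>D\<close>. Half-flatness kills the first two, the symplectic condition the third.\<close>

lemma coclosed_std_G2_form:
  fixes E :: "'a::real_vector list"
  assumes E: "is_basis E" "length E = 6"
    and omega: "CE_d br (wedge (std_omega E) (std_omega E)) = 0"
    and psi: "CE_d br (std_psi_plus E) = 0"
    and sp: "in_sp6 E D"
  shows "CE_d (semidirect_bracket br D)
    (hodge_star (extended_basis E) (std_G2_form (extended_basis E))) = 0"
proof (rule ext)
  fix ps :: "('a \<times> real) list"
  define \<Phi> where "\<Phi> = hodge_star (extended_basis E) (std_G2_form (extended_basis E))"
  have len: "length (extended_basis E) = 7"
    using E(2) by (simp add: extended_basis_def)
  define W where "W x y z w = wedge (std_omega E) (std_omega E) [x, y, z, w] / 2" for x y z w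
  define P where "P x y z = std_psi_plus E [x, y, z]" for x y z
  define om where "om x y = std_omega E [x, y]" for x y
  have W_eq: "W x y z w = om x y * om z w - om x z * om y w + om x w * om y z" for x y z w
    by (simp add: W_def om_def wedge_std_omega)
  have om_swap: "om y x = - om x y" for x y
    by (simp add: om_def std_omega_swap[of E y x])
  \<comment> \<open>Infinitesimal symplecticity says that \<open>om (D x) y\<close> is symmetric in
    \<open>x\<close> and \<open>y\<close>.\<close>
  have om_D: "om (D x) y = om (D y) x" for x y
  proof -
    have "om (D x) y + om x (D y) = 0" using sp by (simp add: in_sp6_def om_def)
    then show ?thesis using om_swap[of "D y" x] by simp
  qed
  have om_lin: "om (x + x') y = om x y + om x' y" "om (x - x') y = om x y - om x' y"
    "om (r *\<^sub>R x) y = r * om x y" for x x' y r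
    using linear_add[OF linear_std_omega[OF E(1)]] linear_diff[OF linear_std_omega[OF E(1)]]
      linear_scale[OF linear_std_omega[OF E(1)]] by (auto simp: om_def)
  have P_lin: "P (x + x') y z = P x y z + P x' y z" "P (x - x') y z = P x y z - P x' y z"
    "P (r *\<^sub>R x) y z = r * P x y z" for x x' y z r
    using linear_add[OF linear_std_psi_plus[OF E(1)]] linear_diff[OF linear_std_psi_plus[OF E(1)]]
      linear_scale[OF linear_std_psi_plus[OF E(1)]] by (auto simp: P_def)
  have W_lin: "W (x + x') y z w = W x y z w + W x' y z w"
    "W (x - x') y z w = W x y z w - W x' y z w"
    "W (r *\<^sub>R x) y z w = r * W x y z w" for x x' y z w r
    by (simp_all add: W_eq om_lin algebra_simps)
  \<comment> \<open>Since \<open>D\<close> annihilates \<omega>, it annihilates \<open>W\<close>,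
    half of \<omega> \<and> \<omega>. The rewriting puts the arguments of each \<open>om\<close> in
    the order \<open>x, y, z, w\<close>, with \<open>D\<close> on the earlier one, after which all
    terms cancel.\<close>
  have W_D: "W (D x) y z w - W (D y) x z w + W (D z) x y w - W (D w) x y z = 0" for x y z w
    unfolding W_eq om_D[of y x] om_D[of z x] om_D[of z y] om_D[of w x] om_D[of w y] om_D[of w z]
      om_swap[of y x] om_swap[of z x] om_swap[of z y] om_swap[of w x] om_swap[of w y] om_swap[of w z]
    by (simp add: algebra_simps)
  have \<Phi>_eq: "\<Phi> [(x, s), (y, t), (z, u), (w, v)]
      = W x y z w + v * P x y z - u * P x y w + t * P x z w - s * P y z w" for x y z w s t u v
    by (simp add: \<Phi>_def W_def P_def hodge_star_std_G2_form_eval[OF E])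
  define dP where "dP x y z w = - P (br x y) z w + P (br x z) y w - P (br x w) y z
      - P (br y z) x w + P (br y w) x z - P (br z w) x y" for x y z w
  have dP_0: "dP x y z w = 0" for x y z w
    using fun_cong[OF psi, of "[x, y, z, w]"]
    by (simp add: CE_d_3_form dP_def P_def)
  define dW where "dW x y z w v = - W (br x y) z w v + W (br x z) y w v - W (br x w) y z v
      + W (br x v) y z w - W (br y z) x w v + W (br y w) x z v - W (br y v) x z w
      - W (br z w) x y v + W (br z v) x y w - W (br w v) x y z" for x y z w v
  have dW_0: "dW x y z w v = 0" for x y z w v
    using fun_cong[OF omega, of "[x, y, z, w, v]"]
    by (simp add: CE_d_4_form dW_def W_def)
  \<comment> \<open>The derivation action of \<open>D\<close> on \<open>W\<close>, with
    \<open>D\<close> moved into the first slot by skew symmetry; hence the alternating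
    signs.\<close>
  define L where "L x y z w = W (D x) y z w - W (D y) x z w + W (D z) x y w - W (D w) x y z"
    for x y z w
  have L_0: "L x y z w = 0" for x y z w
    unfolding L_def by (rule W_D)
  have "CE_d (semidirect_bracket br D) \<Phi> ps = 0"
  proof (cases "length ps = 5")
    case False
    then show ?thesis
      \<comment> \<open>The dual is a 4-form, so its differential lives on lists of length 5
        only.\<close>
      using CE_d_length[of 4 \<Phi> ps]
        hodge_star_std_G2_form_length[OF is_basis_extended_basis[OF E(1)] len]
      by (simp add: \<Phi>_def)
  next
    case True
    then obtain x0 s0 x1 s1 x2 s2 x3 s3 x4 s4
      where ps: "ps = [(x0, s0), (x1, s1), (x2, s2), (x3, s3), (x4, s4)]"
      by (auto simp: length_Suc_conv eval_nat_numeral)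
    \<comment> \<open>The terms \<open>s\<^sub>i s\<^sub>j P (D x\<^sub>k) \<dots>\<close> cancel in pairs because \<open>d\<eta> = 0\<close>.\<close>
    have "CE_d (semidirect_bracket br D) \<Phi> ps = dW x0 x1 x2 x3 x4
      + s0 * dP x1 x2 x3 x4 - s1 * dP x0 x2 x3 x4 + s2 * dP x0 x1 x3 x4 - s3 * dP x0 x1 x2 x4
      + s4 * dP x0 x1 x2 x3
      - s0 * L x1 x2 x3 x4 + s1 * L x0 x2 x3 x4 - s2 * L x0 x1 x3 x4 + s3 * L x0 x1 x2 x4
      - s4 * L x0 x1 x2 x3"
      unfolding ps CE_d_4_form semidirect_bracket_def prod.case \<Phi>_eq W_lin P_lin
        dW_def dP_def L_def
      by algebra
    then show ?thesis by (simp add: dW_0 dP_0 L_0)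
  qed
  then show "CE_d (semidirect_bracket br D) (hodge_star (extended_basis E)
      (std_G2_form (extended_basis E))) ps = 0 ps"
    by (simp add: \<Phi>_def)
qed

theorem proposition2p1:
  fixes br :: "'a::real_vector \<Rightarrow> 'a \<Rightarrow> 'a"
    and \<omega> \<psi>p \<psi>m :: "'a form"
    and D :: "'a \<Rightarrow> 'a"
    and E :: "'a list"
  assumes "lie_algebra br"
    and "dim (UNIV :: 'a set) = 6"
    and "half_flat br \<omega> \<psi>p"
    and "derivation br D"
    and "canonical_basis E \<omega> \<psi>p \<psi>m"
    and "in_sp6 E D"
  shows "\<exists>\<phi> :: ('a \<times> real) form. G2_form \<phi> \<and> coclosed (semidirect_bracket br D) \<phi>"
proof -
  \<comment> \<open>The basis in which \<open>D\<close> is symplectic is the one to be extended by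
    \<xi>.\<close>
  have E: "is_basis E" "length E = 6" "\<omega> = std_omega E" "\<psi>p = std_psi_plus E"
    using assms(5) by (auto simp: canonical_basis_def)
  have "G2_adapted (extended_basis E) (std_G2_form (extended_basis E))"
    using is_basis_extended_basis[OF E(1)] E(2)
    by (simp add: G2_adapted_def std_G2_form_def extended_basis_def)
  moreover have "CE_d (semidirect_bracket br D)
      (hodge_star (extended_basis E) (std_G2_form (extended_basis E))) = 0"
    using coclosed_std_G2_form[OF E(1,2) _ _ assms(6), of br] assms(3) E(3,4)
    by (simp only: half_flat_def)
  ultimately show ?thesis by (auto simp: G2_form_def coclosed_def)
qed

end
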